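(* There is no finite equational axiomatization over BCCS($A$) that is sound modulo $\simeq_{\rm WIF}$ and ground-complete for BCCS($A$) modulo $\simeq_{\rm WIF}$.
   Context: $A$ is a nonempty countable set of actions, $\tau\notin A$, $A_\tau=A\cup\{\tau\}$. BCCS($A$) terms: $t::=0\mid x\mid\alpha t\mid t+t$ ($x$ a variable, $\alpha\in A_\tau$); closed terms contain no variables. Transitions: $\alpha t\xrightarrow{\alpha}t$; if $t\xrightarrow{\alpha}t'$ then $t+u\xrightarrow{\alpha}t'$ and $u+t\xrightarrow{\alpha}t'$. $\Rightarrow$ is the reflexive-transitive closure of $\xrightarrow{\tau}$. $a_1\cdots a_k\in A^*$ is a weak trace of $s$ if $s\Rightarrow\xrightarrow{a_1}\Rightarrow\cdots\xrightarrow{a_k}\Rightarrow s'$; $\mathcal{WT}(s)$ the set. $(a_1\cdots a_k,B)$, $B\subseteq A^*$, is a weak impossible future of $s$ if $s\Rightarrow\xrightarrow{a_1}\Rightarrow\cdots\xrightarrow{a_k}\Rightarrow s'$ with $\mathcal{WT}(s')\cap B=\emptyset$. $s_1\precsim_{\rm WIF}s_2$ iff weak impossible futures of $s_1$ are those of $s_2$, $\mathcal{WT}(s_1)=\mathcal{WT}(s_2)$, and $s_1\xrightarrow{\tau}$ implies $s_2\xrightarrow{\tau}$; $\simeq_{\rm WIF}$ is its kernel, extended to open terms via all closed substitutions. Equational logic: reflexivity, symmetry, transitivity, substitution instances of axioms, closure under contexts. Sound: every derivable equation holds modulo $\simeq_{\rm WIF}$; ground-complete: closed $p\simeq_{\rm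 WIF}q$ implies $p\approx q$ derivable. *)

theory Defs
  imports Main "HOL-Library.Countable"
begin

text \<open>The alphabet is the type \<open>'a\<close>, so that \<open>'a act\<close> is the alphabet extended by
  the distinct action \<open>Tau\<close>. Variables are drawn from the countably infinite set \<open>nat\<close>.\<close>

datatype 'a act = Tau | Act 'a

datatype 'a bccs =
    Zero
  | Var nat
  | Prefix "'a act" "'a bccs"
  | Plus "'a bccs" "'a bccs"

fun vars :: "'a bccs \<Rightarrow> nat set" where
  "vars Zero = {}"
| "vars (Var x) = {x}"
| "vars (Prefix \<alpha> t) = vars t"
| "vars (Plus t u) = vars t \<union> vars u"

definition closed_term :: "'a bccs \<Rightarrow> bool" where
  "closed_term t \<longleftrightarrow> vars t = {}"

fun subst_term :: "(nat \<Rightarrow> 'a bccs) \<Rightarrow> 'a bccs \<Rightarrow> 'a bccs" where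
  "subst_term \<sigma> Zero = Zero"
| "subst_term \<sigma> (Var x) = \<sigma> x"
| "subst_term \<sigma> (Prefix \<alpha> t) = Prefix \<alpha> (subst_term \<sigma> t)"
| "subst_term \<sigma> (Plus t u) = Plus (subst_term \<sigma> t) (subst_term \<sigma> u)"

definition closed_subst :: "(nat \<Rightarrow> 'a bccs) \<Rightarrow> bool" where
  "closed_subst \<sigma> \<longleftrightarrow> (\<forall>x. closed_term (\<sigma> x))"

inductive step :: "'a bccs \<Rightarrow> 'a act \<Rightarrow> 'a bccs \<Rightarrow> bool" where
  step_prefix: "step (Prefix \<alpha> t) \<alpha> t"
| step_plus_left: "step t \<alpha> t' \<Longrightarrow> step (Plus t u) \<alpha> t'"
| step_plus_right: "step t \<alpha> t' \<Longrightarrow> step (Plus u t) \<alpha> t'"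

definition tau_steps :: "'a bccs \<Rightarrow> 'a bccs \<Rightarrow> bool" where
  "tau_steps = (\<lambda>s s'. step s Tau s')\<^sup>*\<^sup>*"

inductive weak_run :: "'a bccs \<Rightarrow> 'a list \<Rightarrow> 'a bccs \<Rightarrow> bool" where
  weak_run_Nil: "tau_steps s s' \<Longrightarrow> weak_run s [] s'"
| weak_run_Cons:
    "tau_steps s s1 \<Longrightarrow> step s1 (Act a) s2 \<Longrightarrow> weak_run s2 w s' \<Longrightarrow> weak_run s (a # w) s'"

definition weak_traces :: "'a bccs \<Rightarrow> 'a list set" where
  "weak_traces s = {w. \<exists>s'. weak_run s w s'}"

definition weak_impossible_futures :: "'a bccs \<Rightarrow> ('a list \<times> 'a list set) set" where
  "weak_impossible_futures s = {(w, B). \<exists>s'. weak_run s w s' \<and> weak_traces s' \<inter> B = {}}"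

definition wif_preorder :: "'a bccs \<Rightarrow> 'a bccs \<Rightarrow> bool" where
  "wif_preorder s1 s2 \<longleftrightarrow>
     weak_impossible_futures s1 \<subseteq> weak_impossible_futures s2 \<and>
     weak_traces s1 = weak_traces s2 \<and>
     ((\<exists>s'. step s1 Tau s') \<longrightarrow> (\<exists>s'. step s2 Tau s'))"

text \<open>The next relation is meant for closed terms; \<open>wif_equiv_open\<close> is its extension to
  open terms.\<close>

definition wif_equiv :: "'a bccs \<Rightarrow> 'a bccs \<Rightarrow> bool" where
  "wif_equiv s1 s2 \<longleftrightarrow> wif_preorder s1 s2 \<and> wif_preorder s2 s1"

definition wif_equiv_open :: "'a bccs \<Rightarrow> 'a bccs \<Rightarrow> bool" where
  "wif_equiv_open t u \<longleftrightarrow>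
     (\<forall>\<sigma>. closed_subst \<sigma> \<longrightarrow> wif_equiv (subst_term \<sigma> t) (subst_term \<sigma> u))"

inductive derivable :: "('a bccs \<times> 'a bccs) set \<Rightarrow> 'a bccs \<Rightarrow> 'a bccs \<Rightarrow> bool"
  for E :: "('a bccs \<times> 'a bccs) set" where
  derivable_refl: "derivable E t t"
| derivable_sym: "derivable E t u \<Longrightarrow> derivable E u t"
| derivable_trans: "derivable E t u \<Longrightarrow> derivable E u v \<Longrightarrow> derivable E t v"
| derivable_axiom: "(t, u) \<in> E \<Longrightarrow> derivable E (subst_term \<sigma> t) (subst_term \<sigma> u)"
| derivable_prefix: "derivable E t u \<Longrightarrow> derivable E (Prefix \<alpha> t) (Prefix \<alpha> u)"
| derivable_plus_left: "derivable E t u \<Longrightarrow> derivable E (Plus t v) (Plus u v)"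
| derivable_plus_right: "derivable E t u \<Longrightarrow> derivable E (Plus v t) (Plus v u)"

definition sound_wif :: "('a bccs \<times> 'a bccs) set \<Rightarrow> bool" where
  "sound_wif E \<longleftrightarrow> (\<forall>t u. derivable E t u \<longrightarrow> wif_equiv_open t u)"

definition ground_complete_wif :: "('a bccs \<times> 'a bccs) set \<Rightarrow> bool" where
  "ground_complete_wif E \<longleftrightarrow>
     (\<forall>p q. closed_term p \<longrightarrow> closed_term q \<longrightarrow> wif_equiv p q \<longrightarrow> derivable E p q)"

end

theory Submission
  imports Defs
begin

text \<open>
  The equations \<open>\<tau>a\<^sup>2\<^sup>m + \<tau>(a\<^sup>2\<^sup>m + a\<^sup>m) \<approx> \<tau>(a\<^sup>2\<^sup>m + a\<^sup>m)\<close> are sound, because the initial states of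
  \<open>a\<^sup>2\<^sup>m\<close> and \<open>a\<^sup>2\<^sup>m + a\<^sup>m\<close> have the same weak traces. Only the left-hand side can reach, by at least
  one \<open>\<tau>\<close>-step, a state all of whose maximal weak traces are \<open>a\<^sup>2\<^sup>m\<close>. For terms whose nonempty maximal
  traces are \<open>a\<^sup>m\<close> or \<open>a\<^sup>2\<^sup>m\<close>, this property is preserved by every sound axiom of size less than \<open>m\<close>:
  if \<open>t \<Rightarrow> t'\<close> and all maximal traces of \<open>\<sigma>(t')\<close> are \<open>a\<^sup>2\<^sup>m\<close>, the other side of the axiom satisfies
  \<open>u \<Rightarrow> u'\<close> for some \<open>u'\<close> whose variables all occur in \<open>t'\<close>. A maximal trace \<open>a\<^sup>m\<close> of \<open>\<sigma>(u')\<close> would end in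
  a maximal trace, of length at most \<open>m\<close>, of some \<open>\<sigma>(x)\<close>; as \<open>x\<close> also occurs in \<open>t'\<close> at a depth below
  \<open>m\<close>, this gives \<open>\<sigma>(t')\<close> a maximal trace that is shorter than \<open>a\<^sup>2\<^sup>m\<close>.
\<close>

section \<open>Paths\<close>

text \<open>The label list records \<open>Tau\<close> steps too. Runs then split like lists, proper
  \<open>Tau\<close>-runs differ from empty ones by \<open>l \<noteq> []\<close>, and the size of a
  term bounds the length of its runs.\<close>

fun path :: "'a bccs \<Rightarrow> 'a act list \<Rightarrow> 'a bccs \<Rightarrow> bool" where
  "path s [] s' \<longleftrightarrow> s' = s"
| "path s (\<alpha> # l) s' \<longleftrightarrow> (\<exists>s1. step s \<alpha> s1 \<and> path s1 l s')"

fun visible :: "'a act list \<Rightarrow> 'a list" where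
  "visible [] = []"
| "visible (Tau # l) = visible l"
| "visible (Act a # l) = a # visible l"

lemma visible_append [simp]: "visible (l @ l') = visible l @ visible l'"
  by (induction l rule: visible.induct) auto

lemma length_visible: "length (visible l) \<le> length l"
  by (induction l rule: visible.induct) auto

lemma path_append: "path s (l @ l') s' \<longleftrightarrow> (\<exists>s1. path s l s1 \<and> path s1 l' s')"
  by (induction l arbitrary: s) auto

lemma tau_steps_iff_path: "tau_steps s s' \<longleftrightarrow> (\<exists>l. path s l s' \<and> visible l = [])"
proof
  assume "tau_steps s s'"
  then have "(\<lambda>s s'. step s Tau s')\<^sup>*\<^sup>* s s'" by (simp add: tau_steps_def)
  then show "\<exists>l. path s l s' \<and> visible l = []"
  proof (induction rule: converse_rtranclp_induct)
    case base
    have "path s' [] s' \<and> visible [] = []" by simp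
    then show ?case by blast
  next
    case (step y z)
    then obtain l where "path z l s'" "visible l = []" by blast
    with step.hyps have "path y (Tau # l) s' \<and> visible (Tau # l) = []" by auto
    then show ?case by blast
  qed
next
  assume "\<exists>l. path s l s' \<and> visible l = []"
  then obtain l where "path s l s'" "visible l = []" by blast
  then show "tau_steps s s'"
    unfolding tau_steps_def
    by (induction l arbitrary: s rule: visible.induct)
      (auto intro: converse_rtranclp_into_rtranclp)
qed

lemma weak_run_tau: "step s Tau s1 \<Longrightarrow> weak_run s1 w s' \<Longrightarrow> weak_run s w s'"
  unfolding weak_run.simps[of s] weak_run.simps[of s1] tau_steps_def
  by (blast intro: converse_rtranclp_into_rtranclp)

lemma weak_run_iff_path: "weak_run s w s' \<longleftrightarrow> (\<exists>l. path s l s' \<and> visible l = w)"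
proof
  assume "weak_run s w s'"
  then show "\<exists>l. path s l s' \<and> visible l = w"
  proof (induction rule: weak_run.induct)
    case (weak_run_Nil s s')
    then show ?case by (simp add: tau_steps_iff_path)
  next
    case (weak_run_Cons s s1 a s2 w s')
    then obtain l l' where "path s l s1" "visible l = []" "path s2 l' s'" "visible l' = w"
      by (auto simp: tau_steps_iff_path)
    with weak_run_Cons.hyps have "path s (l @ Act a # l') s' \<and> visible (l @ Act a # l') = a # w"
      by (auto simp: path_append)
    then show ?case by blast
  qed
next
  assume "\<exists>l. path s l s' \<and> visible l = w"
  then obtain l where "path s l s'" "visible l = w" by blast
  then show "weak_run s w s'"
  proof (induction l arbitrary: s w rule: visible.induct)
    case 1
    then show ?case by (auto simp: tau_steps_def intro: weak_run_Nil)
  next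
    case (2 l)
    then show ?case by (auto intro: weak_run_tau)
  next
    case (3 a l)
    then show ?case by (auto simp: tau_steps_def intro: weak_run_Cons)
  qed
qed

lemma weak_traces_iff: "w \<in> weak_traces s \<longleftrightarrow> (\<exists>l s'. path s l s' \<and> visible l = w)"
  by (auto simp: weak_traces_def weak_run_iff_path)

lemma weak_impossible_futures_iff:
  "(w, B) \<in> weak_impossible_futures s \<longleftrightarrow>
    (\<exists>l s'. path s l s' \<and> visible l = w \<and> weak_traces s' \<inter> B = {})"
  by (auto simp: weak_impossible_futures_def weak_run_iff_path)

\<comment> \<open>Runs and weak traces of sums and prefixes\<close>
inductive_simps step_Zero [simp]: "step Zero \<alpha> s"
inductive_simps step_Var [simp]: "step (Var x) \<alpha> s"
inductive_simps step_Prefix [simp]: "step (Prefix \<beta> t) \<alpha> s"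
inductive_simps step_Plus [simp]: "step (Plus t u) \<alpha> s"

lemma path_Zero [simp]: "path Zero l s \<longleftrightarrow> l = [] \<and> s = Zero"
  by (cases l) auto

lemma path_Plus: "path (Plus t u) l s \<longleftrightarrow>
    l = [] \<and> s = Plus t u \<or> l \<noteq> [] \<and> (path t l s \<or> path u l s)"
  by (cases l) auto

lemma path_Prefix: "path (Prefix \<alpha> t) l s \<longleftrightarrow>
    l = [] \<and> s = Prefix \<alpha> t \<or> (\<exists>l'. l = \<alpha> # l' \<and> path t l' s)"
  by (cases l) auto

lemma Nil_in_weak_traces [simp]: "[] \<in> weak_traces s"
proof -
  have "path s [] s \<and> visible [] = []" by simp
  then show ?thesis unfolding weak_traces_iff by blast
qed

lemma weak_traces_Plus [simp]: "weak_traces (Plus t u) = weak_traces t \<union> weak_traces u"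
proof (rule set_eqI)
  fix w
  show "w \<in> weak_traces (Plus t u) \<longleftrightarrow> w \<in> weak_traces t \<union> weak_traces u"
  proof (cases "w = []")
    case False
    then have "visible l = w \<Longrightarrow> l \<noteq> []" for l by auto
    then show ?thesis by (auto simp: weak_traces_iff path_Plus)
  qed simp
qed

lemma weak_traces_Tau [simp]: "weak_traces (Prefix Tau t) = weak_traces t"
proof (rule set_eqI)
  fix w
  show "w \<in> weak_traces (Prefix Tau t) \<longleftrightarrow> w \<in> weak_traces t"
  proof (cases "w = []")
    case False
    then have "visible l = w \<Longrightarrow> l \<noteq> []" for l by auto
    then show ?thesis
      by (auto simp: weak_traces_iff path_Prefix) (metis visible.simps(2))
  qed simp
qed

lemma weak_traces_path_subset:
  "path s l s' \<Longrightarrow> visible l = [] \<Longrightarrow> weak_traces s' \<subseteq> weak_traces s"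
  by (auto simp: weak_traces_iff) (metis append_Nil path_append visible_append)

lemma wif_equivD:
  assumes "wif_equiv p q"
  shows "weak_impossible_futures p = weak_impossible_futures q"
    and "(\<exists>s. step p Tau s) \<longleftrightarrow> (\<exists>s. step q Tau s)"
  using assms by (auto simp: wif_equiv_def wif_preorder_def)

lemma wif_equiv_sym: "wif_equiv p q \<Longrightarrow> wif_equiv q p"
  by (auto simp: wif_equiv_def)

text \<open>The extra summand contributes only the state \<open>x\<close> itself, which has the same
  weak traces as \<open>Plus x y\<close>; every nonempty run of \<open>x\<close> is already a run of
  \<open>Plus x y\<close>.\<close>

lemma wif_equiv_absorb:
  assumes "weak_traces y \<subseteq> weak_traces x"
  shows "wif_equiv (Plus (Prefix Tau x) (Prefix Tau (Plus x y))) (Prefix Tau (Plus x y))"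
    (is "wif_equiv ?L ?R")
proof -
  have T: "weak_traces ?L = weak_traces ?R" using assms by auto
  have "(w, B) \<in> weak_impossible_futures ?R" if wL: "(w, B) \<in> weak_impossible_futures ?L" for w B
  proof -
    from wL obtain l s where l: "path ?L l s" "visible l = w" "weak_traces s \<inter> B = {}"
      by (auto simp: weak_impossible_futures_iff)
    then consider "l = []" "s = ?L" | "path ?R l s" | l' where "l = Tau # l'" "path x l' s"
      unfolding path_Plus[of "Prefix Tau x"] path_Prefix[of Tau x] by blast
    then show ?thesis
    proof cases
      case 1
      then have "path ?R l ?R" by simp
      with 1 l T show ?thesis unfolding weak_impossible_futures_iff by metis
    next
      case 2
      with l show ?thesis unfolding weak_impossible_futures_iff by blast
    next
      case (3 l')
      show ?thesis
      proof (cases "l' = []")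
        case True
        with 3 have "path ?R l (Plus x y)" "weak_traces (Plus x y) = weak_traces s"
          using assms by auto
        with l show ?thesis unfolding weak_impossible_futures_iff by metis
      next
        case False
        with 3 have "path ?R l s" by (auto simp: path_Prefix path_Plus)
        with l show ?thesis unfolding weak_impossible_futures_iff by blast
      qed
    qed
  qed
  moreover have "(w, B) \<in> weak_impossible_futures ?L"
    if wR: "(w, B) \<in> weak_impossible_futures ?R" for w B
  proof -
    from wR obtain l s where l: "path ?R l s" "visible l = w" "weak_traces s \<inter> B = {}"
      by (auto simp: weak_impossible_futures_iff)
    show ?thesis
    proof (cases "l = []")
      case True
      with l have "path ?L l ?L" "weak_traces s = weak_traces ?L" using T by auto
      with l show ?thesis unfolding weak_impossible_futures_iff by metis
    next
      case False
      with l have "path ?L l s" by (simp add: path_Plus)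
      with l show ?thesis unfolding weak_impossible_futures_iff by blast
    qed
  qed
  ultimately have "weak_impossible_futures ?L = weak_impossible_futures ?R" by auto
  with T show ?thesis by (auto simp: wif_equiv_def wif_preorder_def)
qed

section \<open>Paths of substitution instances\<close>

text \<open>These are the variables outside the scope of any prefix: the initial steps of their
  instances are initial steps of the whole instance.\<close>

fun top_vars :: "'a bccs \<Rightarrow> nat set" where
  "top_vars (Var x) = {x}"
| "top_vars (Plus t u) = top_vars t \<union> top_vars u"
| "top_vars _ = {}"

lemma step_subst_iff:
  "step (subst_term \<sigma> t) \<alpha> s \<longleftrightarrow>
    (\<exists>t'. step t \<alpha> t' \<and> s = subst_term \<sigma> t') \<or> (\<exists>x\<in>top_vars t. step (\<sigma> x) \<alpha> s)"
  by (induction t) auto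

lemma path_substI: "path t l t' \<Longrightarrow> path (subst_term \<sigma> t) l (subst_term \<sigma> t')"
  by (induction l arbitrary: t) (auto simp: step_subst_iff)

text \<open>The run in \<open>\<sigma> x\<close> has to be nonempty, because before its first step
  the state is the instance of \<open>t'\<close>, not \<open>\<sigma> x\<close>.\<close>

lemma path_subst_varI:
  assumes "path t l t'" "x \<in> top_vars t'" "path (\<sigma> x) l' s" "l' \<noteq> []"
  shows "path (subst_term \<sigma> t) (l @ l') s"
proof -
  have "path (subst_term \<sigma> t') l' s"
    using assms(2-4) by (cases l') (auto simp: step_subst_iff)
  with assms(1) show ?thesis by (auto simp: path_append dest: path_substI)
qed

text \<open>A run of an instance either stays within the term or, from the first step contributed by
  an unguarded variable on, is a run of the instance of that variable.\<close>

lemma path_substE: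
  assumes "path (subst_term \<sigma> t) l s"
  obtains t' where "path t l t'" "s = subst_term \<sigma> t'"
  | l1 l2 t' x where "l = l1 @ l2" "l2 \<noteq> []" "path t l1 t'" "x \<in> top_vars t'" "path (\<sigma> x) l2 s"
proof -
  have "(\<exists>t'. path t l t' \<and> s = subst_term \<sigma> t') \<or>
    (\<exists>l1 l2 t' x. l = l1 @ l2 \<and> l2 \<noteq> [] \<and> path t l1 t' \<and> x \<in> top_vars t' \<and> path (\<sigma> x) l2 s)"
    using assms
  proof (induction l arbitrary: t)
    case (Cons \<alpha> l)
    then obtain s1 where s1: "step (subst_term \<sigma> t) \<alpha> s1" "path s1 l s" by auto
    then consider t1 where "step t \<alpha> t1" "s1 = subst_term \<sigma> t1"
      | x where "x \<in> top_vars t" "step (\<sigma> x) \<alpha> s1"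
      by (auto simp: step_subst_iff)
    then show ?case
    proof cases
      case (1 t1)
      with s1 Cons.IH[of t1] consider t' where "path t1 l t'" "s = subst_term \<sigma> t'"
        | l1 l2 t' x where "l = l1 @ l2" "l2 \<noteq> []" "path t1 l1 t'" "x \<in> top_vars t'"
          "path (\<sigma> x) l2 s"
        by blast
      then show ?thesis
      proof cases
        case inner: (1 t')
        with 1 have "path t (\<alpha> # l) t'" by auto
        with inner show ?thesis by blast
      next
        case (2 l1 l2 t' x)
        with 1 have "path t (\<alpha> # l1) t'" "\<alpha> # l = (\<alpha> # l1) @ l2" by auto
        with 2 show ?thesis by blast
      qed
    next
      case (2 x)
      with s1 have "path (\<sigma> x) (\<alpha> # l) s" "path t [] t" "\<alpha> # l = [] @ (\<alpha> # l)" by auto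
      with 2 show ?thesis by blast
    qed
  qed simp
  then show thesis using that by blast
qed

section \<open>Size bounds and occurrences of variables\<close>

lemma step_vars_size: "step t \<alpha> t' \<Longrightarrow> vars t' \<subseteq> vars t \<and> size t' < size t"
  by (induction rule: step.induct) auto

lemma path_vars_size: "path t l t' \<Longrightarrow> vars t' \<subseteq> vars t \<and> size t' + length l \<le> size t"
proof (induction l arbitrary: t)
  case (Cons \<alpha> l)
  then obtain t1 where t1: "step t \<alpha> t1" "path t1 l t'" by auto
  from step_vars_size[OF t1(1)] Cons.IH[OF t1(2)] show ?case by auto
qed simp

lemma path_visible_size: "path t l t' \<Longrightarrow> length (visible l) \<le> size t"
  using path_vars_size[of t l t'] length_visible[of l] by simp

lemma top_vars_subset: "top_vars t \<subseteq> vars t"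
  by (induction t) auto

lemma vars_reachable: "x \<in> vars t \<Longrightarrow> \<exists>l t'. path t l t' \<and> x \<in> top_vars t'"
proof (induction t)
  case (Var y)
  then have "path (Var y) [] (Var y) \<and> x \<in> top_vars (Var y)" by simp
  then show ?case by blast
next
  case (Prefix \<alpha> t)
  then obtain l t' where "path t l t'" "x \<in> top_vars t'" by auto
  then have "path (Prefix \<alpha> t) (\<alpha> # l) t' \<and> x \<in> top_vars t'" by simp
  then show ?case by blast
next
  case (Plus t u)
  then obtain l t' where l: "path t l t' \<or> path u l t'" "x \<in> top_vars t'" by auto
  \<comment> \<open>A summand is not itself a state reached from the sum, so the empty path is
    replaced by the one ending in the whole sum.\<close>
  show ?case
  proof (cases "l = []")
    case True
    with l have "path (Plus t u) [] (Plus t u) \<and> x \<in> top_vars (Plus t u)" by auto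
    then show ?thesis by blast
  next
    case False
    with l show ?thesis by (auto simp: path_Plus)
  qed
qed simp

lemma vars_subst: "vars (subst_term \<sigma> t) = (\<Union>x\<in>vars t. vars (\<sigma> x))"
  by (induction t) auto

lemma subst_subst: "subst_term \<sigma> (subst_term \<rho> t) = subst_term (\<lambda>x. subst_term \<sigma> (\<rho> x)) t"
  by (induction t) auto

lemma subst_closed: "closed_term t \<Longrightarrow> subst_term \<sigma> t = t"
  by (induction t) (auto simp: closed_term_def)

section \<open>The invariant\<close>

primrec act_power :: "'a \<Rightarrow> nat \<Rightarrow> 'a bccs" where
  "act_power a 0 = Zero"
| "act_power a (Suc n) = Prefix (Act a) (act_power a n)"

lemma closed_act_power [simp]: "closed_term (act_power a n)"
  by (induction n) (auto simp: closed_term_def)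

lemma path_act_power:
  "path (act_power a n) l s \<longleftrightarrow>
    (\<exists>k\<le>n. l = replicate k (Act a) \<and> s = act_power a (n - k))"
proof (induction n arbitrary: l)
  case (Suc n)
  show ?case
  proof (cases l)
    case (Cons \<alpha> l')
    have "(\<exists>k\<le>Suc n. \<alpha> # l' = replicate k (Act a) \<and> s = act_power a (Suc n - k)) \<longleftrightarrow>
        \<alpha> = Act a \<and> (\<exists>k\<le>n. l' = replicate k (Act a) \<and> s = act_power a (n - k))"
      (is "?A \<longleftrightarrow> ?B")
    proof
      assume ?A
      then obtain k where "k \<le> Suc n" "\<alpha> # l' = replicate k (Act a)" "s = act_power a (Suc n - k)"
        by blast
      then show ?B by (cases k) auto
    next
      assume ?B
      then obtain k where "k \<le> n" "\<alpha> = Act a" "l' = replicate k (Act a)" "s = act_power a (n - k)"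
        by blast
      then show ?A by (intro exI[of _ "Suc k"]) auto
    qed
    with Cons Suc.IH[of l'] show ?thesis by auto
  qed auto
qed simp

lemma visible_replicate [simp]: "visible (replicate k (Act a)) = replicate k a"
  by (induction k) auto

lemma weak_traces_act_power: "weak_traces (act_power a n) = {replicate k a | k. k \<le> n}"
  by (auto simp: weak_traces_iff path_act_power) (metis visible_replicate)

lemma replicate_eq_replicate: "replicate k a = replicate n a \<longleftrightarrow> k = n"
  by (metis length_replicate)

text \<open>These are the maximal weak traces. Expressing them by impossible futures, with all
  nonempty words refused, makes them invariant under the equivalence at once.\<close>

definition quiescent_traces :: "'a bccs \<Rightarrow> 'a list set" where
  "quiescent_traces p = {w. (w, - {[]}) \<in> weak_impossible_futures p}"

lemma quiescent_traces_iff: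
  "w \<in> quiescent_traces p \<longleftrightarrow> (\<exists>l s. path p l s \<and> visible l = w \<and> weak_traces s \<subseteq> {[]})"
  by (auto simp: quiescent_traces_def weak_impossible_futures_iff disjoint_eq_subset_Compl)

lemma quiescent_traces_path_subset:
  "path p l p' \<Longrightarrow> visible l = [] \<Longrightarrow> quiescent_traces p' \<subseteq> quiescent_traces p"
  by (auto simp: quiescent_traces_iff) (metis append_Nil path_append visible_append)

lemma quiescent_act_power: "weak_traces (act_power a n) \<subseteq> {[]} \<longleftrightarrow> n = 0"
proof
  have "replicate n a \<in> weak_traces (act_power a n)" by (auto simp: weak_traces_act_power)
  then show "n = 0" if "weak_traces (act_power a n) \<subseteq> {[]}" using that by auto
qed (auto simp: weak_traces_iff)

definition uniform :: "'a \<Rightarrow> nat \<Rightarrow> 'a bccs \<Rightarrow> bool" where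
  "uniform a m p \<longleftrightarrow> quiescent_traces p \<subseteq> {replicate (2 * m) a}"

text \<open>Requiring at least one \<open>Tau\<close> step makes the property distribute over sums,
  which share exactly their nonempty runs with their summands.\<close>

definition tau_uniform :: "'a \<Rightarrow> nat \<Rightarrow> 'a bccs \<Rightarrow> bool" where
  "tau_uniform a m p \<longleftrightarrow> (\<exists>l p'. path p l p' \<and> l \<noteq> [] \<and> visible l = [] \<and> uniform a m p')"

text \<open>The empty trace is admitted so that admissibility passes from a sum to its summands, one of
  which may be \<open>0\<close>.\<close>

definition admissible :: "'a \<Rightarrow> nat \<Rightarrow> 'a bccs \<Rightarrow> bool" where
  "admissible a m p \<longleftrightarrow>
     quiescent_traces p \<subseteq> {[], replicate m a, replicate (2 * m) a} \<and>
     ((\<exists>s. step p Tau s) \<longrightarrow> ([], {replicate (2 * m) a}) \<notin> weak_impossible_futures p)"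

section \<open>Behaviour of the invariant under equivalence and in contexts\<close>

lemma uniform_cong: "wif_equiv p q \<Longrightarrow> uniform a m p \<longleftrightarrow> uniform a m q"
  by (simp add: uniform_def quiescent_traces_def wif_equivD(1))

lemma admissible_cong: "wif_equiv p q \<Longrightarrow> admissible a m p \<longleftrightarrow> admissible a m q"
  by (simp add: admissible_def quiescent_traces_def wif_equivD)

lemma uniform_path: "uniform a m p \<Longrightarrow> path p l p' \<Longrightarrow> visible l = [] \<Longrightarrow> uniform a m p'"
  using quiescent_traces_path_subset by (fastforce simp: uniform_def)

lemma tau_uniform_Plus: "tau_uniform a m (Plus p q) \<longleftrightarrow> tau_uniform a m p \<or> tau_uniform a m q"
  by (auto simp: tau_uniform_def path_Plus)

text \<open>The leading \<open>Tau\<close> makes the empty run of \<open>p\<close> count, which is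
  why \<open>uniform\<close> of \<open>p\<close> itself appears.\<close>

lemma tau_uniform_Tau: "tau_uniform a m (Prefix Tau p) \<longleftrightarrow> uniform a m p \<or> tau_uniform a m p"
proof
  assume "tau_uniform a m (Prefix Tau p)"
  then obtain l p' where "path p l p'" "visible l = []" "uniform a m p'"
    by (auto simp: tau_uniform_def path_Prefix)
  then show "uniform a m p \<or> tau_uniform a m p"
    by (cases "l = []") (auto simp: tau_uniform_def)
next
  assume "uniform a m p \<or> tau_uniform a m p"
  then obtain l p' where l: "path p l p'" "visible l = []" "uniform a m p'"
  proof
    assume u: "uniform a m p"
    show thesis by (rule that[of "[]" p]) (use u in auto)
  qed (auto simp: tau_uniform_def)
  then have "path (Prefix Tau p) (Tau # l) p'" "visible (Tau # l) = []" by auto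
  with l(3) show "tau_uniform a m (Prefix Tau p)" unfolding tau_uniform_def by blast
qed

lemma tau_uniform_Act: "\<not> tau_uniform a m (Prefix (Act b) p)"
  by (auto simp: tau_uniform_def path_Prefix)

lemma admissible_TauD:
  assumes "admissible a m (Prefix Tau p)"
  shows "admissible a m p"
proof -
  have "path (Prefix Tau p) [Tau] p" "visible [Tau] = []" by auto
  then have "quiescent_traces p \<subseteq> quiescent_traces (Prefix Tau p)"
    by (rule quiescent_traces_path_subset)
  moreover have "([], B) \<in> weak_impossible_futures (Prefix Tau p)"
    if "([], B) \<in> weak_impossible_futures p" for B
    using that unfolding weak_impossible_futures_iff path_Prefix
    by (metis visible.simps(2))
  ultimately show ?thesis using assms by (auto simp: admissible_def)
qed

lemma admissible_Plus_leftD: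
  assumes "admissible a m (Plus p r)"
  shows "admissible a m p"
  unfolding admissible_def
proof (intro conjI impI notI)
  show "quiescent_traces p \<subseteq> {[], replicate m a, replicate (2 * m) a}"
  proof
    fix w
    assume "w \<in> quiescent_traces p"
    then obtain l s where l: "path p l s" "visible l = w" "weak_traces s \<subseteq> {[]}"
      by (auto simp: quiescent_traces_iff)
    show "w \<in> {[], replicate m a, replicate (2 * m) a}"
    proof (cases "l = []")
      case False
      with l have "w \<in> quiescent_traces (Plus p r)"
        unfolding quiescent_traces_iff path_Plus by blast
      with assms show ?thesis by (auto simp: admissible_def)
    qed (use l in auto)
  qed
next
  assume "\<exists>s. step p Tau s" and wif: "([], {replicate (2 * m) a}) \<in> weak_impossible_futures p"
  then obtain p1 where p1: "step p Tau p1" by blast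
  from wif obtain l s where l: "path p l s" "visible l = []" "replicate (2 * m) a \<notin> weak_traces s"
    by (auto simp: weak_impossible_futures_iff)
  \<comment> \<open>A nonempty run is needed to pass to the sum. If \<open>p\<close> itself lacks
    the trace a^(2m), so does its \<open>Tau\<close>-derivative \<open>p1\<close>, whose weak traces
    are among those of \<open>p\<close>.\<close>
  obtain l' s' where l': "path p l' s'" "l' \<noteq> []" "visible l' = []"
    "replicate (2 * m) a \<notin> weak_traces s'"
  proof (cases "l = []")
    case True
    from p1 have "path p [Tau] p1" by simp
    moreover from this have "weak_traces p1 \<subseteq> weak_traces p"
      by (rule weak_traces_path_subset) simp
    ultimately show thesis using that[of "[Tau]" p1] True l by auto
  qed (use l that in blast)
  then have "path (Plus p r) l' s'" by (simp add: path_Plus)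
  with l' have "([], {replicate (2 * m) a}) \<in> weak_impossible_futures (Plus p r)"
    unfolding weak_impossible_futures_iff by blast
  with assms p1 show False by (auto simp: admissible_def)
qed

text \<open>Sums commute up to equivalence, and admissibility respects equivalence.\<close>

lemma admissible_Plus_rightD: "admissible a m (Plus r p) \<Longrightarrow> admissible a m p"
proof -
  assume A: "admissible a m (Plus r p)"
  have T: "weak_traces (Plus r p) = weak_traces (Plus p r)" by auto
  have "(w, B) \<in> weak_impossible_futures (Plus r p) \<longleftrightarrow>
      (w, B) \<in> weak_impossible_futures (Plus p r)" for w B
    unfolding weak_impossible_futures_iff path_Plus using T by metis
  then have "wif_equiv (Plus r p) (Plus p r)"
    using T by (auto simp: wif_equiv_def wif_preorder_def)
  with A have "admissible a m (Plus p r)" using admissible_cong by metis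
  then show ?thesis by (rule admissible_Plus_leftD)
qed

section \<open>Small sound equations preserve the invariant\<close>

text \<open>Instantiating \<open>x\<close> by a power longer than \<open>u\<close>, and all other variables by \<open>0\<close>, turns the
  occurrence of \<open>x\<close> into a maximal trace that can only start at a \<open>\<tau>\<close>-derivative of \<open>u\<close>.\<close>

lemma tau_reachable_top_var_transfer:
  fixes t u :: "'a bccs"
  assumes eq: "wif_equiv_open t u"
    and t: "path t l t'" "visible l = []" "x \<in> top_vars t'"
  shows "\<exists>l u'. path u l u' \<and> visible l = [] \<and> x \<in> top_vars u'"
proof -
  fix a :: 'a
  define N where "N = Suc (size u)"
  define \<rho> where "\<rho> = (\<lambda>y. if y = x then act_power a N else Zero)"
  have "closed_subst \<rho>"
    by (auto simp: closed_subst_def \<rho>_def closed_term_def[of Zero])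
  with eq have eq': "wif_equiv (subst_term \<rho> t) (subst_term \<rho> u)"
    by (simp add: wif_equiv_open_def)
  have "path (\<rho> x) (replicate N (Act a)) Zero"
    by (simp add: \<rho>_def path_act_power)
  then have "path (subst_term \<rho> t) (l @ replicate N (Act a)) Zero"
    using t by (intro path_subst_varI) (auto simp: N_def)
  moreover have "visible (l @ replicate N (Act a)) = replicate N a" using t by simp
  moreover have "weak_traces (Zero :: 'a bccs) \<subseteq> {[]}" by (auto simp: weak_traces_iff)
  ultimately have "replicate N a \<in> quiescent_traces (subst_term \<rho> t)"
    unfolding quiescent_traces_iff by blast
  then have "replicate N a \<in> quiescent_traces (subst_term \<rho> u)"
    using wif_equivD(1)[OF eq'] by (simp add: quiescent_traces_def)
  then obtain k s where k: "path (subst_term \<rho> u) k s" "visible k = replicate N a"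
      "weak_traces s \<subseteq> {[]}"
    by (auto simp: quiescent_traces_iff)
  from k(1) show ?thesis
  proof (cases rule: path_substE)
    case (1 u')
    then have "N \<le> size u" using path_visible_size[of u k u'] k(2) by simp
    then show ?thesis by (simp add: N_def)
  next
    case (2 l1 l2 u' y)
    then have y: "y = x" by (auto simp: \<rho>_def split: if_splits)
    with 2 obtain j where j: "j \<le> N" "l2 = replicate j (Act a)" "s = act_power a (N - j)"
      by (auto simp: \<rho>_def path_act_power)
    \<comment> \<open>Quiescence of the final state means that the power is used up, so all
      \<open>N\<close> visible actions come from \<open>x\<close> and none from
      \<open>l1\<close>.\<close>
    with k(3) have "j = N" by (simp add: quiescent_act_power)
    with j 2 k(2) have "length (visible l1) = 0"
      using arg_cong[OF k(2), of length] by simp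
    with 2 y show ?thesis by auto
  qed
qed

text \<open>Here the variables of \<open>t'\<close> are instantiated by \<open>0\<close> and all others by a power longer than
  \<open>t'\<close>.\<close>

lemma tau_reachable_vars_transfer:
  fixes t u :: "'a bccs"
  assumes eq: "wif_equiv_open t u"
    and t: "path t l t'" "visible l = []"
  shows "\<exists>l u'. path u l u' \<and> visible l = [] \<and> vars u' \<subseteq> vars t'"
proof -
  fix a :: 'a
  define N where "N = Suc (size t')"
  define \<rho> where "\<rho> = (\<lambda>y. if y \<in> vars t' then Zero else act_power a N)"
  have "closed_subst \<rho>"
    by (auto simp: closed_subst_def \<rho>_def closed_term_def[of Zero])
  with eq have eq': "wif_equiv (subst_term \<rho> t) (subst_term \<rho> u)"
    by (simp add: wif_equiv_open_def)
  \<comment> \<open>Refusing the complement of the trace set of the instance of \<open>t'\<close>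
    turns the impossible future into a trace inclusion.\<close>
  have "([], - weak_traces (subst_term \<rho> t')) \<in> weak_impossible_futures (subst_term \<rho> t)"
    unfolding weak_impossible_futures_iff using path_substI[OF t(1), of \<rho>] t(2) by blast
  then have "([], - weak_traces (subst_term \<rho> t')) \<in> weak_impossible_futures (subst_term \<rho> u)"
    using wif_equivD(1)[OF eq'] by simp
  then obtain k s where k: "path (subst_term \<rho> u) k s" "visible k = []"
    and s: "weak_traces s \<subseteq> weak_traces (subst_term \<rho> t')"
    by (auto simp: weak_impossible_futures_iff disjoint_eq_subset_Compl)
  from k(1) show ?thesis
  proof (cases rule: path_substE)
    case (1 u')
    have "vars u' \<subseteq> vars t'"
    proof (rule ccontr)
      assume "\<not> vars u' \<subseteq> vars t'"
      then obtain x where x: "x \<in> vars u'" "x \<notin> vars t'" by blast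
      then obtain l1 u'' where l1: "path u' l1 u''" "x \<in> top_vars u''"
        using vars_reachable by blast
      have "path (\<rho> x) (replicate N (Act a)) Zero"
        using x by (simp add: \<rho>_def path_act_power)
      \<comment> \<open>An occurrence of \<open>x\<close> in \<open>u'\<close> gives
        \<open>s\<close> a trace of length at least \<open>N\<close>.\<close>
      with l1 have "path s (l1 @ replicate N (Act a)) Zero"
        unfolding 1(2) by (intro path_subst_varI) (auto simp: N_def)
      then have "visible (l1 @ replicate N (Act a)) \<in> weak_traces (subst_term \<rho> t')"
        using s unfolding weak_traces_iff[of _ s] subset_iff by blast
      then obtain l2 s2 where l2: "path (subst_term \<rho> t') l2 s2"
          "visible l2 = visible (l1 @ replicate N (Act a))"
        by (auto simp: weak_traces_iff)
      \<comment> \<open>All variables of \<open>t'\<close> become \<open>Zero\<close>, so the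
        instance moves only as \<open>t'\<close> does and its traces are shorter than
        \<open>N\<close>.\<close>
      from l2(1) show False
      proof (cases rule: path_substE)
        case (1 t2)
        then show False
          using path_visible_size[of t' l2 t2] l2(2) by (simp add: N_def)
      next
        case (2 l3 l4 t2 y)
        then have "y \<in> vars t'" using top_vars_subset path_vars_size by blast
        with 2 show False by (simp add: \<rho>_def)
      qed
    qed
    with 1 k(2) show ?thesis by blast
  next
    \<comment> \<open>Both \<open>Zero\<close> and the power are free of \<open>Tau\<close> steps,
      so no nonempty invisible run can lie inside an instance of a variable.\<close>
    case (2 l1 l2 u' y)
    then show ?thesis using k(2)
      by (auto simp: \<rho>_def path_act_power split: if_splits)
  qed
qed

text \<open>The \<open>Tau\<close>-run of the instance of \<open>t\<close> may end within
  \<open>t\<close> or inside some \<open>\<sigma> x\<close>. The first case compares the variables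
  of \<open>t'\<close> and \<open>u'\<close>; in the second, \<open>x\<close> is also unguarded in a
  \<open>Tau\<close>-derivative of \<open>u\<close>, and the same run of \<open>\<sigma> x\<close>
  is taken there.\<close>

lemma tau_uniform_transfer:
  assumes eq: "wif_equiv_open t u" and \<sigma>: "closed_subst \<sigma>"
    and size: "size t < m" "size u < m"
    and adm: "admissible a m (subst_term \<sigma> u)"
    and uni: "tau_uniform a m (subst_term \<sigma> t)"
  shows "tau_uniform a m (subst_term \<sigma> u)"
proof -
  from eq \<sigma> have eq': "wif_equiv (subst_term \<sigma> t) (subst_term \<sigma> u)"
    by (simp add: wif_equiv_open_def)
  from uni obtain l p where l: "path (subst_term \<sigma> t) l p" "l \<noteq> []" "visible l = []"
    and p: "uniform a m p"
    by (auto simp: tau_uniform_def)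
  \<comment> \<open>The equivalence preserves the existence of an initial \<open>Tau\<close> step,
    which activates the second clause of \<open>admissible\<close>: every state that the instance of
    \<open>u\<close> reaches invisibly has the trace a^(2m).\<close>
  have "\<exists>s. step (subst_term \<sigma> t) Tau s"
    using l by (cases l rule: visible.cases) auto
  then obtain s1 where s1: "step (subst_term \<sigma> u) Tau s1"
    using wif_equivD(2)[OF eq'] by blast
  then have no_wif: "([], {replicate (2 * m) a}) \<notin> weak_impossible_futures (subst_term \<sigma> u)"
    using adm by (auto simp: admissible_def)
  from l(1) show ?thesis
  proof (cases rule: path_substE)
    case (1 t')
    obtain k u' where k: "path u k u'" "visible k = []" "vars u' \<subseteq> vars t'"
      using tau_reachable_vars_transfer[OF eq 1(1) l(3)] by blast
    have k\<sigma>: "path (subst_term \<sigma> u) k (subst_term \<sigma> u')" using k(1) by (rule path_substI)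
    have "uniform a m (subst_term \<sigma> u')"
      unfolding uniform_def
    proof
      fix w
      assume w: "w \<in> quiescent_traces (subst_term \<sigma> u')"
      then have "w \<in> quiescent_traces (subst_term \<sigma> u)"
        using quiescent_traces_path_subset[OF k\<sigma> k(2)] by blast
      then consider "w = replicate (2 * m) a" | "w = []" | "w = replicate m a"
        using adm by (auto simp: admissible_def)
      then show "w \<in> {replicate (2 * m) a}"
      proof cases
        \<comment> \<open>A quiescent state reached invisibly would lack a^(2m), which is nonempty
          because the size bounds force \<open>m\<close> to be positive.\<close>
        case 2
        with w obtain j s where j: "path (subst_term \<sigma> u') j s" "visible j = []"
            "weak_traces s \<subseteq> {[]}"
          by (auto simp: quiescent_traces_iff)
        with k\<sigma> have "path (subst_term \<sigma> u) (k @ j) s" by (auto simp: path_append)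
        moreover have "weak_traces s \<inter> {replicate (2 * m) a} = {}"
          using j(3) size by auto
        moreover have "visible (k @ j) = []" using k j by simp
        ultimately show ?thesis using no_wif unfolding weak_impossible_futures_iff by blast
      next
        case 3
        with w obtain j s where j: "path (subst_term \<sigma> u') j s" "visible j = replicate m a"
            "weak_traces s \<subseteq> {[]}"
          by (auto simp: quiescent_traces_iff)
        \<comment> \<open>The term \<open>u'\<close> is too small to perform m visible actions
          alone, so the run must enter some \<open>\<sigma> x\<close>.\<close>
        from j(1) show ?thesis
        proof (cases rule: path_substE)
          case (1 u'')
          then have "m \<le> size u'" using path_visible_size[of u' j u''] j(2) by simp
          then show ?thesis using path_vars_size[OF k(1)] size by simp
        next
          case (2 j1 j2 u'' x)
          then have "x \<in> vars t'"
            using k(3) top_vars_subset path_vars_size by blast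
          then obtain i t'' where i: "path t' i t''" "x \<in> top_vars t''"
            using vars_reachable by blast
          with 2 have "path (subst_term \<sigma> t') (i @ j2) s" by (intro path_subst_varI)
          with j(3) have "visible (i @ j2) \<in> quiescent_traces (subst_term \<sigma> t')"
            unfolding quiescent_traces_iff by blast
          \<comment> \<open>The lengths conflict: \<open>j2\<close> has at most m visible actions
            and \<open>i\<close> fewer than m, but together they must have 2m.\<close>
          then have "length (visible i) + length (visible j2) = 2 * m"
            using p 1(2) by (auto simp: uniform_def dest!: arg_cong[of _ "replicate _ _" length])
          moreover have "length (visible j1) + length (visible j2) = m"
            using arg_cong[OF j(2), of length] 2(1) by simp
          moreover have "length (visible i) < m"
            using path_visible_size[OF i(1)] path_vars_size[OF 1(1)] size by simp
          ultimately show ?thesis by simp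
        qed
      qed simp
    qed
    \<comment> \<open>If \<open>k\<close> is empty, the instance of \<open>u\<close> is itself
      uniform; uniformity passes to its derivative \<open>s1\<close>, which supplies the required
      \<open>Tau\<close> step.\<close>
    show ?thesis
    proof (cases "k = []")
      case True
      with k(1) have "uniform a m (subst_term \<sigma> u)"
        using \<open>uniform a m (subst_term \<sigma> u')\<close> by simp
      moreover have s1': "path (subst_term \<sigma> u) [Tau] s1" using s1 by simp
      ultimately have "uniform a m s1" by (rule uniform_path) simp
      with s1' show ?thesis
        unfolding tau_uniform_def by (intro exI[of _ "[Tau]"] exI[of _ s1]) simp
    next
      case False
      with k\<sigma> k(2) \<open>uniform a m (subst_term \<sigma> u')\<close> show ?thesis
        unfolding tau_uniform_def by blast
    qed
  next
    case (2 l1 l2 t' x)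
    with l(3) have "visible l1 = []" "visible l2 = []" by auto
    with 2 obtain k u' where k: "path u k u'" "visible k = []" "x \<in> top_vars u'"
      using tau_reachable_top_var_transfer[OF eq] by blast
    with 2 have "path (subst_term \<sigma> u) (k @ l2) p" by (intro path_subst_varI)
    with 2 k(2) \<open>visible l2 = []\<close> p show ?thesis
      unfolding tau_uniform_def by (metis Nil_is_append_conv append_Nil visible_append)
  qed
qed

text \<open>Induction on the derivation under one closed substitution. Soundness carries
  admissibility across equations, and admissibility is inherited by summands and by the body of a
  \<open>Tau\<close> prefix; an action prefix has no initial \<open>Tau\<close> step at all.\<close>

lemma derivable_tau_uniform:
  assumes sound: "sound_wif E"
    and size: "\<And>t u. (t, u) \<in> E \<Longrightarrow> size t < m \<and> size u < m"
    and "derivable E t u" "closed_subst \<sigma>" "admissible a m (subst_term \<sigma> t)"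
  shows "tau_uniform a m (subst_term \<sigma> t) \<longleftrightarrow> tau_uniform a m (subst_term \<sigma> u)"
  using assms(3-5)
proof (induction rule: derivable.induct)
  case (derivable_sym t u)
  then show ?case
    using sound admissible_cong unfolding sound_wif_def wif_equiv_open_def by metis
next
  case (derivable_trans t u v)
  then show ?case
    using sound admissible_cong unfolding sound_wif_def wif_equiv_open_def by metis
next
  case (derivable_axiom t u \<rho>)
  let ?\<sigma> = "\<lambda>x. subst_term \<sigma> (\<rho> x)"
  \<comment> \<open>The identity substitution makes the axiom itself derivable, hence sound; the
    instance under \<open>\<rho>\<close> is then handled by composing substitutions.\<close>
  have "derivable E (subst_term Var t) (subst_term Var u)"
    using derivable_axiom.hyps by (rule derivable.derivable_axiom)
  moreover have "subst_term Var v = v" for v :: "'a bccs" by (induction v) auto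
  ultimately have eq: "wif_equiv_open t u" using sound by (simp add: sound_wif_def)
  then have eq': "wif_equiv_open u t"
    by (auto simp: wif_equiv_open_def intro: wif_equiv_sym)
  have cl: "closed_subst ?\<sigma>"
    using derivable_axiom.prems(1) by (simp add: closed_subst_def closed_term_def vars_subst)
  have adm: "admissible a m (subst_term ?\<sigma> t)"
    using derivable_axiom.prems(2) by (simp add: subst_subst)
  have "admissible a m (subst_term ?\<sigma> u)"
    using adm admissible_cong eq cl unfolding wif_equiv_open_def by metis
  with adm cl size[OF derivable_axiom.hyps]
    tau_uniform_transfer[OF eq cl, of m a] tau_uniform_transfer[OF eq' cl, of m a]
  show ?case unfolding subst_subst by blast
next
  case (derivable_prefix t u \<alpha>)
  show ?case
  proof (cases \<alpha>)
    case Tau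
    \<comment> \<open>The induction hypothesis covers proper \<open>Tau\<close>-runs below the
      prefix; the empty run needs \<open>uniform\<close>, which is invariant under the
      equivalence.\<close>
    have "wif_equiv (subst_term \<sigma> t) (subst_term \<sigma> u)"
      using derivable_prefix sound unfolding sound_wif_def wif_equiv_open_def by blast
    then have "uniform a m (subst_term \<sigma> t) \<longleftrightarrow> uniform a m (subst_term \<sigma> u)"
      by (rule uniform_cong)
    moreover have "admissible a m (subst_term \<sigma> t)"
      using derivable_prefix.prems(2) Tau by (auto dest: admissible_TauD)
    ultimately show ?thesis
      using derivable_prefix Tau by (simp add: tau_uniform_Tau)
  qed (simp add: tau_uniform_Act)
next
  case (derivable_plus_left t u v)
  then show ?case by (simp add: tau_uniform_Plus) (metis admissible_Plus_leftD)
next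
  case (derivable_plus_right t u v)
  then show ?case by (simp add: tau_uniform_Plus) (metis admissible_Plus_rightD)
qed simp

section \<open>The family of equations\<close>

lemma quiescent_traces_act_power: "quiescent_traces (act_power a n) = {replicate n a}"
proof (rule set_eqI)
  fix w
  have "w \<in> quiescent_traces (act_power a n) \<longleftrightarrow>
      (\<exists>k\<le>n. w = replicate k a \<and> weak_traces (act_power a (n - k)) \<subseteq> {[]})"
    unfolding quiescent_traces_iff path_act_power by (metis visible_replicate)
  also have "\<dots> \<longleftrightarrow> w \<in> {replicate n a}"
    unfolding quiescent_act_power by auto
  finally show "w \<in> quiescent_traces (act_power a n) \<longleftrightarrow> w \<in> {replicate n a}" .
qed

lemma quiescent_traces_Tau: "quiescent_traces (Prefix Tau p) = quiescent_traces p"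
proof
  show "quiescent_traces p \<subseteq> quiescent_traces (Prefix Tau p)"
    by (rule quiescent_traces_path_subset[of _ "[Tau]"]) auto
  show "quiescent_traces (Prefix Tau p) \<subseteq> quiescent_traces p"
  proof
    fix w
    assume "w \<in> quiescent_traces (Prefix Tau p)"
    then obtain l s where l: "path (Prefix Tau p) l s" "visible l = w" "weak_traces s \<subseteq> {[]}"
      by (auto simp: quiescent_traces_iff)
    show "w \<in> quiescent_traces p"
    proof (cases "l = []")
      case True
      with l have "path p l p" "weak_traces p \<subseteq> {[]}" by auto
      with l(2) show ?thesis unfolding quiescent_traces_iff by blast
    next
      case False
      with l obtain l' where "path p l' s" "visible l' = w" by (auto simp: path_Prefix)
      with l(3) show ?thesis unfolding quiescent_traces_iff by blast
    qed
  qed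
qed

lemma quiescent_traces_Plus_act_power:
  assumes "0 < m" "0 < n"
  shows "quiescent_traces (Plus (act_power a n) (act_power a m)) = {replicate n a, replicate m a}"
proof (rule set_eqI)
  fix w
  let ?p = "Plus (act_power a n) (act_power a m)"
  have neq: "\<not> weak_traces ?p \<subseteq> {[]}"
    using assms by (simp add: quiescent_act_power)
  \<comment> \<open>A process that is not quiescent reaches its maximal traces by nonempty runs
    only, and those are shared between a sum and its summands.\<close>
  have "(\<exists>l s. path q l s \<and> l \<noteq> [] \<and> visible l = w \<and> weak_traces s \<subseteq> {[]}) \<longleftrightarrow>
      w \<in> quiescent_traces q" if "\<not> weak_traces q \<subseteq> {[]}" for q :: "'a bccs"
    using that unfolding quiescent_traces_iff by (metis path.simps(1))
  note * = this[of ?p] this[of "act_power a n"] this[of "act_power a m"]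
  have "w \<in> quiescent_traces ?p \<longleftrightarrow>
      w \<in> quiescent_traces (act_power a n) \<or> w \<in> quiescent_traces (act_power a m)"
    using assms neq
    by (subst *(1)[symmetric], simp, subst *(2)[symmetric], simp add: quiescent_act_power,
        subst *(3)[symmetric], simp add: quiescent_act_power) (auto simp: path_Plus)
  then show "w \<in> quiescent_traces ?p \<longleftrightarrow> w \<in> {replicate n a, replicate m a}"
    by (simp add: quiescent_traces_act_power)
qed

theorem theorem5p12:
  shows "\<not> (\<exists>E :: ('a::countable bccs \<times> 'a bccs) set.
           finite E \<and> sound_wif E \<and> ground_complete_wif E)"
proof
  assume "\<exists>E :: ('a bccs \<times> 'a bccs) set. finite E \<and> sound_wif E \<and> ground_complete_wif E"
  then obtain E :: "('a bccs \<times> 'a bccs) set"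
    where E: "finite E" "sound_wif E" "ground_complete_wif E" by blast
  fix a :: 'a
  \<comment> \<open>The sum over the finite set \<open>E\<close> bounds every term size in it, and
    the successor makes the bound strict.\<close>
  define m where "m = Suc (\<Sum>(t, u)\<in>E. size t + size u)"
  have m: "0 < m" by (simp add: m_def)
  have size: "size t < m \<and> size u < m" if "(t, u) \<in> E" for t u
    using member_le_sum[OF that, of "\<lambda>(t, u). size t + size u"] E(1) by (auto simp: m_def)
  let ?x = "act_power a (2 * m)"
  let ?z = "Plus ?x (act_power a m)"
  let ?L = "Plus (Prefix Tau ?x) (Prefix Tau ?z)"
  let ?R = "Prefix Tau ?z"
  have closed: "closed_term ?L" "closed_term ?R"
    using closed_act_power[of a] by (auto simp: closed_term_def)
  have "weak_traces (act_power a m) \<subseteq> weak_traces ?x"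
    by (auto simp: weak_traces_act_power)
  then have eq: "wif_equiv ?L ?R" by (rule wif_equiv_absorb)
  have R: "quiescent_traces ?R = {replicate (2 * m) a, replicate m a}"
    using m by (simp add: quiescent_traces_Tau quiescent_traces_Plus_act_power)
  \<comment> \<open>The only states reached invisibly are \<open>?R\<close> and \<open>?z\<close>,
    and both have the trace a^(2m).\<close>
  have "([], {replicate (2 * m) a}) \<notin> weak_impossible_futures ?R"
    by (auto simp: weak_impossible_futures_iff path_Prefix path_Plus path_act_power
        weak_traces_act_power)
  with R have "admissible a m ?R" by (simp add: admissible_def)
  then have adm: "admissible a m ?L" using admissible_cong[OF eq] by simp
  have "derivable E ?L ?R" using E(3) eq closed by (simp add: ground_complete_wif_def)
  \<comment> \<open>Both sides are closed, so any closed substitution leaves them unchanged.\<close>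
  moreover have "closed_subst (\<lambda>_. Zero :: 'a bccs)"
    by (simp add: closed_subst_def closed_term_def)
  ultimately have "tau_uniform a m ?L \<longleftrightarrow> tau_uniform a m ?R"
    using derivable_tau_uniform[OF E(2) size, of ?L ?R "\<lambda>_. Zero" a] adm
      subst_closed[OF closed(1)] subst_closed[OF closed(2)]
    by metis
  moreover have "tau_uniform a m ?L"
    by (simp add: tau_uniform_Plus tau_uniform_Tau uniform_def quiescent_traces_act_power)
  moreover have "\<not> tau_uniform a m ?R"
  proof -
    \<comment> \<open>The summand a^m adds a second maximal trace, different from a^(2m) since m is
      positive.\<close>
    have "\<not> uniform a m ?z"
      using m by (simp add: uniform_def quiescent_traces_Plus_act_power replicate_eq_replicate)
    moreover have "\<not> tau_uniform a m (act_power a n)" for n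
      by (cases n) (auto simp: tau_uniform_Act tau_uniform_def[of _ _ Zero])
    ultimately show ?thesis by (simp add: tau_uniform_Tau tau_uniform_Plus)
  qed
  ultimately show False by blast
qed

end
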